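(* Let $X$ be a smooth projective complex curve of genus $g\ge 1$, $N$ a line bundle on $X$, $\delta\in\mathbb{Q}_{>0}$, and let $(E,Q)$ be a quadric bundle on $X$, i.e. $E$ is a vector bundle of rank $r$ and degree $d$ on $X$ and $Q\colon\mathrm{Sym}^2E\to N$ is a nonzero morphism of vector bundles. The following are equivalent: (A) $(E,Q)$ is $\delta$-semistable (respectively $\delta$-stable), i.e. $P(E^\bullet,\underline\alpha)+\delta\,\mu(E^\bullet,\underline\alpha;Q)\ge 0$ (respectively $>0$) for every weighted filtration $(E^\bullet,\underline\alpha)$ of $E$. (B) Both of the following hold: (1) for every proper nonzero subbundle $F$ of $E$, $$\frac{\deg(F)-\delta\,k_{F,E}}{\mathrm{rk}(F)}\ \le\ \frac{d-2\delta}{r}\qquad(\text{respectively }<);$$ (2) for every critical filtration $0\subsetneq E_1\subsetneq E_2\subsetneq E$ (of length two, with both weights equal to $1$), with $r_i=\mathrm{rk}(E_i)$ and $d_i=\deg(E_i)$, $$(r_1+r_2)\,d-r\,(d_1+d_2)-2\delta\,(r_1+r_2-r)\ \ge\ 0\qquad(\text{respectively }>0).$$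
   Context: A weighted filtration $(E^\bullet,\underline\alpha)$ of $E$ of length $t\ge 1$ consists of a chain of subbundles $0\subsetneq E_1\subsetneq\cdots\subsetneq E_t\subsetneq E$ together with a vector $\underline\alpha=(\alpha_1,\dots,\alpha_t)$ of positive rational weights. Put $E_{t+1}=E$, $r_i=\mathrm{rk}(E_i)$, $d_i=\deg(E_i)$. Define $$P(E^\bullet,\underline\alpha)=\sum_{i=1}^t\alpha_i\,(d\,r_i-r\,d_i),$$ $$\gamma=\sum_{i=1}^t\alpha_i\,(\underbrace{r_i-r,\dots,r_i-r}_{r_i\text{ times}},\underbrace{r_i,\dots,r_i}_{r-r_i\text{ times}})\in\mathbb{Q}^r,$$ and let $\gamma^{(i)}$, for $i\in\{1,\dots,t+1\}$, denote the $r_i$-th entry of $\gamma$. For subbundles $A,B\subset E$, $AB$ denotes the subbundle of $\mathrm{Sym}^2E$ generated by products $ab$ of local sections $a$ of $A$ and $b$ of $B$. Define $$\mu(E^\bullet,\underline\alpha;Q)=-\min_{i,j\in\{1,\dots,t+1\}}\{\gamma^{(i)}+\gamma^{(j)}\;:\;Q|_{E_iE_j}\not\equiv 0\}.$$ A weighted filtration is called non-critical if $\mu(E^\bullet,\underline\alpha;Q)=\sum_{i=1}^t\mu(0\subset E_i\subset E,\alpha_i;Q)$, and critical otherwise; a filtration without specified weights has all weights equal to $1$. For a subbundle $F\subset E$, $k_{F,E}=2$ if $Q|_{FF}\ne0$; $k_{F,E}=1$ if $Q|_{FF}=0$ and $Q|_{FE}\neq0$; $k_{F,E}=0$ if $Q|_{FE}=0$.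 *)

theory Defs
  imports "HOL-Analysis.Analysis" "HOL-Combinatorics.Permutations"
begin

section \<open>Closed subvarieties of complex projective space\<close>

text \<open>
  Points of the projective space with homogeneous coordinates indexed by \<open>'n\<close> are the lines
  through the origin in \<open>complex ^ 'n\<close>; so its dimension is \<open>CARD('n) - 1\<close>.
\<close>

type_synonym 'n point = "(complex ^ 'n) set"

definition proj_space :: "('n::finite) point set" where
  "proj_space = {p. vec.subspace p \<and> vec.dim p = 1}"

inductive_set polynomial_functions :: "(complex ^ 'n::finite \<Rightarrow> complex) set" where
  const: "(\<lambda>v. c) \<in> polynomial_functions"
| coord: "(\<lambda>v. v $ i) \<in> polynomial_functions"
| add: "f \<in> polynomial_functions \<Longrightarrow> g \<in> polynomial_functions
          \<Longrightarrow> (\<lambda>v. f v + g v) \<in> polynomial_functions"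
| mult: "f \<in> polynomial_functions \<Longrightarrow> g \<in> polynomial_functions
          \<Longrightarrow> (\<lambda>v. f v * g v) \<in> polynomial_functions"

text \<open>
  As \<open>complex\<close> is infinite, a polynomial is homogeneous of degree \<open>k\<close> iff the function it defines
  scales with the \<open>k\<close>-th power. The zero polynomial is homogeneous of every degree.
\<close>

definition homogeneous :: "nat \<Rightarrow> (complex ^ 'n::finite \<Rightarrow> complex) \<Rightarrow> bool" where
  "homogeneous k f \<longleftrightarrow> f \<in> polynomial_functions \<and> (\<forall>c v. f (c *s v) = c ^ k * f v)"

definition vanishes_at :: "(complex ^ 'n::finite \<Rightarrow> complex) \<Rightarrow> 'n point \<Rightarrow> bool" where
  "vanishes_at f p \<longleftrightarrow> (\<forall>v\<in>p. f v = 0)"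

definition zariski_closed :: "('n::finite) point set \<Rightarrow> bool" where
  "zariski_closed Z \<longleftrightarrow>
     (\<exists>S. (\<forall>f\<in>S. \<exists>k. homogeneous k f) \<and> Z = {p \<in> proj_space. \<forall>f\<in>S. vanishes_at f p})"

definition zariski_open :: "('n::finite) point set \<Rightarrow> 'n point set \<Rightarrow> bool" where
  "zariski_open X U \<longleftrightarrow> U \<subseteq> X \<and> zariski_closed (X - U)"

definition irreducible_closed :: "('n::finite) point set \<Rightarrow> bool" where
  "irreducible_closed Z \<longleftrightarrow> zariski_closed Z \<and> Z \<noteq> {} \<and>
     (\<forall>A B. zariski_closed A \<and> zariski_closed B \<and> Z \<subseteq> A \<union> B \<longrightarrow> Z \<subseteq> A \<or> Z \<subseteq> B)"

definition variety_dim :: "('n::finite) point set \<Rightarrow> nat" where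
  "variety_dim X = (GREATEST m. \<exists>Z::nat \<Rightarrow> 'n point set.
     (\<forall>i\<le>m. irreducible_closed (Z i) \<and> Z i \<subseteq> X) \<and> (\<forall>i<m. Z i \<subset> Z (Suc i)))"

text \<open>
  The kernel of the Jacobian matrix, at the vector \<open>v\<close>, of the homogeneous forms vanishing on \<open>X\<close>:
  this is the tangent space of the affine cone over \<open>X\<close>, whence the \<open>1 +\<close> in the Jacobian criterion
  below.
\<close>

definition cone_tangent_space :: "('n::finite) point set \<Rightarrow> complex ^ 'n \<Rightarrow> (complex ^ 'n) set" where
  "cone_tangent_space X v =
     {w. \<forall>k f. homogeneous k f \<and> (\<forall>p\<in>X. vanishes_at f p) \<longrightarrow> deriv (\<lambda>z. f (v + z *s w)) 0 = 0}"

definition smooth_variety :: "('n::finite) point set \<Rightarrow> bool" where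
  "smooth_variety X \<longleftrightarrow>
     (\<forall>p\<in>X. \<forall>v\<in>p. v \<noteq> 0 \<longrightarrow> vec.dim (cone_tangent_space X v) = 1 + variety_dim X)"

definition smooth_projective_curve :: "('n::finite) point set \<Rightarrow> bool" where
  "smooth_projective_curve X \<longleftrightarrow>
     irreducible_closed X \<and> variety_dim X = 1 \<and> smooth_variety X"


section \<open>Regular functions, orders of vanishing and the genus\<close>

definition regular_on :: "('n::finite) point set \<Rightarrow> 'n point set \<Rightarrow> ('n point \<Rightarrow> complex) \<Rightarrow> bool" where
  "regular_on X U f \<longleftrightarrow>
     (\<forall>p\<in>U. \<exists>V k a b. zariski_open X V \<and> p \<in> V \<and> V \<subseteq> U \<and> homogeneous k a \<and> homogeneous k b \<and>
        (\<forall>q\<in>V. \<forall>v\<in>q. v \<noteq> 0 \<longrightarrow> b v \<noteq> 0 \<and> f q = a v / b v))"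

text \<open>Representatives of the elements of the local ring of \<open>X\<close> at \<open>p\<close>.\<close>

definition local_ring :: "('n::finite) point set \<Rightarrow> 'n point \<Rightarrow> ('n point \<Rightarrow> complex) set" where
  "local_ring X p = {f. \<exists>U. zariski_open X U \<and> p \<in> U \<and> regular_on X U f}"

definition agree_near ::
  "('n::finite) point set \<Rightarrow> 'n point \<Rightarrow> ('n point \<Rightarrow> complex) \<Rightarrow> ('n point \<Rightarrow> complex) \<Rightarrow> bool" where
  "agree_near X p f g \<longleftrightarrow> (\<exists>U. zariski_open X U \<and> p \<in> U \<and> (\<forall>q\<in>U. f q = g q))"

text \<open>A generator of the maximal ideal of the local ring.\<close>

definition uniformizer :: "('n::finite) point set \<Rightarrow> 'n point \<Rightarrow> ('n point \<Rightarrow> complex) \<Rightarrow> bool" where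
  "uniformizer X p t \<longleftrightarrow> t \<in> local_ring X p \<and> t p = 0 \<and>
     (\<forall>g\<in>local_ring X p. g p = 0 \<longrightarrow> (\<exists>h\<in>local_ring X p. agree_near X p g (\<lambda>q. t q * h q)))"

text \<open>
  \<open>has_order_at X p W f m\<close>: the rational function on the curve \<open>X\<close> given by \<open>f\<close>, regular and not
  identically zero on the nonempty open set \<open>W\<close>, is a unit times the \<open>m\<close>-th power of a uniformizer
  at \<open>p\<close>. The point \<open>p\<close> need not belong to \<open>W\<close>.
\<close>

definition has_order_at ::
  "('n::finite) point set \<Rightarrow> 'n point \<Rightarrow> 'n point set \<Rightarrow> ('n point \<Rightarrow> complex) \<Rightarrow> int \<Rightarrow> bool" where
  "has_order_at X p W f m \<longleftrightarrow>
     (\<exists>V t u. uniformizer X p t \<and> zariski_open X V \<and> p \<in> V \<and> regular_on X V u \<and> u p \<noteq> 0 \<and>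
        (\<forall>q \<in> V \<inter> W - {p}. f q = u q * t q powi m))"

text \<open>Tangent vectors at \<open>p\<close> are the derivations of the local ring into its residue field.\<close>

definition derivation_at ::
  "('n::finite) point set \<Rightarrow> 'n point \<Rightarrow> (('n point \<Rightarrow> complex) \<Rightarrow> complex) \<Rightarrow> bool" where
  "derivation_at X p D \<longleftrightarrow>
     (\<forall>f\<in>local_ring X p. \<forall>g\<in>local_ring X p.
        (agree_near X p f g \<longrightarrow> D f = D g) \<and>
        D (\<lambda>q. f q + g q) = D f + D g \<and>
        D (\<lambda>q. f q * g q) = f p * D g + g p * D f) \<and>
     (\<forall>c. \<forall>f\<in>local_ring X p. D (\<lambda>q. c * f q) = c * D f)"

text \<open>
  A regular differential form assigns to each point a cotangent vector (a functional on tangent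
  vectors) which is locally of the form \<open>\<Sum>\<^sub>i f\<^sub>i dg\<^sub>i\<close> with regular functions \<open>f\<^sub>i\<close> and \<open>g\<^sub>i\<close>.
\<close>

definition regular_differential ::
  "('n::finite) point set \<Rightarrow> ('n point \<Rightarrow> (('n point \<Rightarrow> complex) \<Rightarrow> complex) \<Rightarrow> complex) \<Rightarrow> bool" where
  "regular_differential X \<omega> \<longleftrightarrow>
     (\<forall>p\<in>X. \<exists>U (m::nat) f g. zariski_open X U \<and> p \<in> U \<and>
        (\<forall>i<m. regular_on X U (f i) \<and> regular_on X U (g i)) \<and>
        (\<forall>q\<in>U. \<forall>D. derivation_at X q D \<longrightarrow> \<omega> q D = (\<Sum>i<m. f i q * D (g i))))"

text \<open>
  The genus is the dimension of the space of regular differential forms, as the maximal number of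
  linearly independent ones (only the values on actual tangent vectors matter).
\<close>

definition genus :: "('n::finite) point set \<Rightarrow> nat" where
  "genus X = (GREATEST m. \<exists>\<omega>. (\<forall>i<m. regular_differential X (\<omega> i)) \<and>
     (\<forall>c::nat \<Rightarrow> complex.
        (\<forall>p\<in>X. \<forall>D. derivation_at X p D \<longrightarrow> (\<Sum>i<m. c i * \<omega> i p D) = 0) \<longrightarrow> (\<forall>i<m. c i = 0)))"


section \<open>Vector bundles, subbundles and degree\<close>

text \<open>
  A vector bundle of rank \<open>CARD('r)\<close> is given by an atlas of local trivialisations \<open>(U, \<phi>)\<close>, where
  \<open>\<phi> p\<close> is a linear isomorphism from the fibre over \<open>p \<in> U\<close> to \<open>complex ^ 'r\<close>, with regular
  transition matrices. The fibres are taken to be \<open>complex ^ 'r\<close> as bare vector spaces; this is no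
  restriction, since the bases of the fibres may be chosen pointwise, without any compatibility:
  the algebraic structure of the bundle is carried entirely by the atlas.
\<close>

type_synonym ('n, 'r) atlas = "('n point set \<times> ('n point \<Rightarrow> complex ^ 'r ^ 'r)) set"

type_synonym ('n, 'r) fibre_family = "'n point \<Rightarrow> (complex ^ 'r) set"

definition vector_bundle :: "('n::finite) point set \<Rightarrow> ('n, 'r::finite) atlas \<Rightarrow> bool" where
  "vector_bundle X E \<longleftrightarrow>
     (\<forall>(U, \<phi>)\<in>E. zariski_open X U \<and> (\<forall>p\<in>U. invertible (\<phi> p))) \<and>
     (\<Union>(U, \<phi>)\<in>E. U) = X \<and>
     (\<forall>(U, \<phi>)\<in>E. \<forall>(V, \<psi>)\<in>E. \<forall>i j.
        regular_on X (U \<inter> V) (\<lambda>p. (\<psi> p ** matrix_inv (\<phi> p)) $ i $ j))"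

abbreviation line_bundle :: "('n::finite) point set \<Rightarrow> ('n, 1) atlas \<Rightarrow> bool" where
  "line_bundle \<equiv> vector_bundle"

definition regular_section ::
  "('n::finite) point set \<Rightarrow> ('n, 'r::finite) atlas \<Rightarrow> 'n point set \<Rightarrow> ('n point \<Rightarrow> complex ^ 'r) \<Rightarrow> bool"
  where
  "regular_section X E U s \<longleftrightarrow>
     (\<forall>(V, \<phi>)\<in>E. \<forall>i. regular_on X (U \<inter> V) (\<lambda>p. (\<phi> p *v s p) $ i))"

definition is_frame ::
  "('n::finite) point set \<Rightarrow> ('n, 'r::finite) atlas \<Rightarrow> ('n, 'r) fibre_family \<Rightarrow> 'n point set \<Rightarrow>
   nat \<Rightarrow> (nat \<Rightarrow> 'n point \<Rightarrow> complex ^ 'r) \<Rightarrow> bool" where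
  "is_frame X E F U k s \<longleftrightarrow> zariski_open X U \<and> (\<forall>i<k. regular_section X E U (s i)) \<and>
     (\<forall>p\<in>U. inj_on (\<lambda>i. s i p) {..<k} \<and> vec.independent ((\<lambda>i. s i p) ` {..<k}) \<and>
        vec.span ((\<lambda>i. s i p) ` {..<k}) = F p)"

text \<open>Subbundles; the values of \<open>F\<close> outside \<open>X\<close> are irrelevant.\<close>

definition subbundle ::
  "('n::finite) point set \<Rightarrow> ('n, 'r::finite) atlas \<Rightarrow> ('n, 'r) fibre_family \<Rightarrow> bool" where
  "subbundle X E F \<longleftrightarrow> (\<exists>k. \<forall>p\<in>X. \<exists>U s. p \<in> U \<and> is_frame X E F U k s)"

definition zero_sub :: "('n, 'r::finite) fibre_family" where
  "zero_sub = (\<lambda>p. {0})"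

definition whole :: "('n, 'r::finite) fibre_family" where
  "whole = (\<lambda>p. UNIV)"

definition strict_sub ::
  "('n::finite) point set \<Rightarrow> ('n, 'r::finite) fibre_family \<Rightarrow> ('n, 'r) fibre_family \<Rightarrow> bool" where
  "strict_sub X F G \<longleftrightarrow> (\<forall>p\<in>X. F p \<subseteq> G p) \<and> (\<exists>p\<in>X. F p \<noteq> G p)"

definition rk :: "('n::finite) point set \<Rightarrow> ('n, 'r::finite) fibre_family \<Rightarrow> nat" where
  "rk X F = (THE k. \<forall>p\<in>X. vec.dim (F p) = k)"

text \<open>The Leibniz formula, for matrices whose size is not given by a type.\<close>

definition det_upto :: "nat \<Rightarrow> (nat \<Rightarrow> nat \<Rightarrow> complex) \<Rightarrow> complex" where
  "det_upto k M = (\<Sum>\<pi> | \<pi> permutes {..<k}. of_int (sign \<pi>) * (\<Prod>i<k. M i (\<pi> i)))"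

text \<open>
  The degree of \<open>F\<close> is the degree of its determinant line bundle, i.e. the degree of the divisor of
  a nonzero rational section of the latter. A frame \<open>s\<close> of \<open>F\<close> over a nonempty open set \<open>U\<close> provides
  such a section, \<open>s\<^sub>0 \<and> \<dots> \<and> s\<^sub>k\<^sub>-\<^sub>1\<close>; its order at \<open>p\<close> is that of the coefficient \<open>det M\<close> with respect
  to \<open>e\<^sub>0 \<and> \<dots> \<and> e\<^sub>k\<^sub>-\<^sub>1\<close>, where \<open>e\<close> is a frame of \<open>F\<close> near \<open>p\<close>. The order is zero at the points of \<open>U\<close>.
\<close>

definition has_frame_order ::
  "('n::finite) point set \<Rightarrow> ('n, 'r::finite) atlas \<Rightarrow> ('n, 'r) fibre_family \<Rightarrow> 'n point set \<Rightarrow>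
   nat \<Rightarrow> (nat \<Rightarrow> 'n point \<Rightarrow> complex ^ 'r) \<Rightarrow> 'n point \<Rightarrow> int \<Rightarrow> bool" where
  "has_frame_order X E F U k s p m \<longleftrightarrow>
     (\<exists>V e M. p \<in> V \<and> is_frame X E F V k e \<and>
        (\<forall>q \<in> U \<inter> V. \<forall>i<k. s i q = (\<Sum>j<k. M q i j *s e j q)) \<and>
        has_order_at X p (U \<inter> V) (\<lambda>q. det_upto k (M q)) m)"

definition bundle_degree ::
  "('n::finite) point set \<Rightarrow> ('n, 'r::finite) atlas \<Rightarrow> ('n, 'r) fibre_family \<Rightarrow> int" where
  "bundle_degree X E F = (THE d. \<exists>U k s ord. U \<noteq> {} \<and> is_frame X E F U k s \<and>
     (\<forall>p \<in> X - U. has_frame_order X E F U k s p (ord p)) \<and> d = (\<Sum>p \<in> X - U. ord p))"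


section \<open>Symmetric squares and quadratic bundles\<close>

text \<open>
  The fibre of \<open>E \<otimes> E\<close> is \<open>complex ^ ('r \<times> 'r)\<close>, and its trivialisations are Kronecker products of
  those of \<open>E\<close>. In characteristic zero the symmetric square is the subbundle of symmetric tensors,
  the product \<open>a b\<close> being the symmetrisation of \<open>a \<otimes> b\<close>.
\<close>

definition kronecker ::
  "complex ^ 'r ^ 'r \<Rightarrow> complex ^ 'r ^ 'r \<Rightarrow> complex ^ ('r \<times> 'r) ^ ('r::finite \<times> 'r)" where
  "kronecker A B = (\<chi> ij kl. A $ fst ij $ fst kl * B $ snd ij $ snd kl)"

definition tensor_square :: "('n::finite, 'r::finite) atlas \<Rightarrow> ('n, 'r \<times> 'r) atlas" where
  "tensor_square E = (\<lambda>(U, \<phi>). (U, \<lambda>p. kronecker (\<phi> p) (\<phi> p))) ` E"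

definition Sym2 :: "('n, 'r::finite \<times> 'r) fibre_family" where
  "Sym2 = (\<lambda>p. {w. \<forall>i j. w $ (i, j) = w $ (j, i)})"

definition sym_prod :: "complex ^ 'r \<Rightarrow> complex ^ 'r \<Rightarrow> complex ^ ('r::finite \<times> 'r)" where
  "sym_prod a b = (\<chi> ij. (a $ fst ij * b $ snd ij + b $ fst ij * a $ snd ij) / 2)"

text \<open>
  Fibrewise span of the products. If one of \<open>A\<close>, \<open>B\<close> contains the other, as for all the products
  of members of a chain below, its rank is constant and it is the subbundle generated by products.
\<close>

definition sub_prod ::
  "('n, 'r::finite) fibre_family \<Rightarrow> ('n, 'r) fibre_family \<Rightarrow> ('n, 'r \<times> 'r) fibre_family" where
  "sub_prod A B = (\<lambda>p. vec.span {sym_prod a b | a b. a \<in> A p \<and> b \<in> B p})"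

text \<open>
  Morphisms from a subbundle \<open>F\<close> of \<open>E\<close> to a bundle \<open>G\<close>: fibrewise linear maps taking regular sections
  to regular sections. Only the values \<open>h p w\<close> with \<open>p \<in> X\<close> and \<open>w \<in> F p\<close> matter.
\<close>

definition bundle_morphism ::
  "('n::finite) point set \<Rightarrow> ('n, 'k::finite) atlas \<Rightarrow> ('n, 'k) fibre_family \<Rightarrow> ('n, 'l::finite) atlas \<Rightarrow>
   ('n point \<Rightarrow> complex ^ 'k \<Rightarrow> complex ^ 'l) \<Rightarrow> bool" where
  "bundle_morphism X E F G h \<longleftrightarrow>
     (\<forall>p\<in>X. (\<forall>v\<in>F p. \<forall>w\<in>F p. h p (v + w) = h p v + h p w) \<and>
             (\<forall>c. \<forall>v\<in>F p. h p (c *s v) = c *s h p v)) \<and>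
     (\<forall>U s. zariski_open X U \<and> regular_section X E U s \<and> (\<forall>p\<in>U. s p \<in> F p)
        \<longrightarrow> regular_section X G U (\<lambda>p. h p (s p)))"

definition nonzero_on ::
  "('n::finite) point set \<Rightarrow> ('n point \<Rightarrow> complex ^ 'k \<Rightarrow> complex ^ 'l) \<Rightarrow>
   ('n, 'k::finite) fibre_family \<Rightarrow> bool" where
  "nonzero_on X h F \<longleftrightarrow> (\<exists>p\<in>X. \<exists>w\<in>F p. h p w \<noteq> (0 :: complex ^ 'l::finite))"

text \<open>A morphism \<open>Q\<close> from the symmetric square of \<open>E\<close> to the line bundle \<open>N\<close>, seen on fibres.\<close>

type_synonym ('n, 'r) quadratic_map = "'n point \<Rightarrow> complex ^ ('r \<times> 'r) \<Rightarrow> complex ^ 1"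

definition quadric_bundle ::
  "('n::finite) point set \<Rightarrow> ('n, 1) atlas \<Rightarrow> ('n, 'r::finite) atlas \<Rightarrow> ('n, 'r) quadratic_map \<Rightarrow> bool"
  where
  "quadric_bundle X N E Q \<longleftrightarrow> vector_bundle X E \<and>
     bundle_morphism X (tensor_square E) Sym2 N Q \<and> nonzero_on X Q Sym2"


section \<open>Weighted filtrations and stability\<close>

text \<open>
  A filtration of length \<open>t\<close> is given by \<open>F 1, \<dots>, F t\<close>; the other values of \<open>F\<close> and of the weights
  are irrelevant. \<open>step t F i\<close> completes it by the whole bundle at \<open>i = t + 1\<close>.
\<close>

definition step :: "nat \<Rightarrow> (nat \<Rightarrow> ('n, 'r::finite) fibre_family) \<Rightarrow> nat \<Rightarrow> ('n, 'r) fibre_family" where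
  "step t F i = (if i = Suc t then whole else F i)"

definition filtration ::
  "('n::finite) point set \<Rightarrow> ('n, 'r::finite) atlas \<Rightarrow> nat \<Rightarrow> (nat \<Rightarrow> ('n, 'r) fibre_family) \<Rightarrow> bool" where
  "filtration X E t F \<longleftrightarrow> t \<ge> 1 \<and> (\<forall>i\<in>{1..t}. subbundle X E (F i)) \<and>
     strict_sub X zero_sub (F 1) \<and> (\<forall>i\<in>{1..t}. strict_sub X (step t F i) (step t F (Suc i)))"

definition weighted_filtration ::
  "('n::finite) point set \<Rightarrow> ('n, 'r::finite) atlas \<Rightarrow> nat \<Rightarrow> (nat \<Rightarrow> ('n, 'r) fibre_family) \<Rightarrow>
   (nat \<Rightarrow> rat) \<Rightarrow> bool" where
  "weighted_filtration X E t F \<alpha> \<longleftrightarrow> filtration X E t F \<and> (\<forall>i\<in>{1..t}. \<alpha> i > 0)"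

definition P_wt ::
  "('n::finite) point set \<Rightarrow> ('n, 'r::finite) atlas \<Rightarrow> nat \<Rightarrow> (nat \<Rightarrow> ('n, 'r) fibre_family) \<Rightarrow>
   (nat \<Rightarrow> rat) \<Rightarrow> rat" where
  "P_wt X E t F \<alpha> = (\<Sum>i=1..t. \<alpha> i *
     (of_int (bundle_degree X E whole) * of_nat (rk X (F i))
      - of_nat CARD('r) * of_int (bundle_degree X E (F i))))"

text \<open>The \<open>j\<close>-th entry, \<open>1 \<le> j \<le> r\<close>, of the vector \<open>\<gamma>\<close>.\<close>

definition gamma_vec ::
  "('n::finite) point set \<Rightarrow> nat \<Rightarrow> (nat \<Rightarrow> ('n, 'r::finite) fibre_family) \<Rightarrow> (nat \<Rightarrow> rat) \<Rightarrow>
   nat \<Rightarrow> rat" where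
  "gamma_vec X t F \<alpha> j = (\<Sum>i=1..t. \<alpha> i *
     (if j \<le> rk X (F i) then of_nat (rk X (F i)) - of_nat CARD('r) else of_nat (rk X (F i))))"

definition gamma ::
  "('n::finite) point set \<Rightarrow> nat \<Rightarrow> (nat \<Rightarrow> ('n, 'r::finite) fibre_family) \<Rightarrow> (nat \<Rightarrow> rat) \<Rightarrow>
   nat \<Rightarrow> rat" where
  "gamma X t F \<alpha> i = gamma_vec X t F \<alpha> (rk X (step t F i))"

definition mu ::
  "('n::finite) point set \<Rightarrow> ('n, 'r::finite) quadratic_map \<Rightarrow> nat \<Rightarrow>
   (nat \<Rightarrow> ('n, 'r) fibre_family) \<Rightarrow> (nat \<Rightarrow> rat) \<Rightarrow> rat" where
  "mu X Q t F \<alpha> = - Min {gamma X t F \<alpha> i + gamma X t F \<alpha> j | i j.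
     i \<in> {1..t+1} \<and> j \<in> {1..t+1} \<and> nonzero_on X Q (sub_prod (step t F i) (step t F j))}"

definition noncritical ::
  "('n::finite) point set \<Rightarrow> ('n, 'r::finite) quadratic_map \<Rightarrow> nat \<Rightarrow>
   (nat \<Rightarrow> ('n, 'r) fibre_family) \<Rightarrow> (nat \<Rightarrow> rat) \<Rightarrow> bool" where
  "noncritical X Q t F \<alpha> \<longleftrightarrow> mu X Q t F \<alpha> = (\<Sum>i=1..t. mu X Q 1 (\<lambda>_. F i) (\<lambda>_. \<alpha> i))"

abbreviation critical ::
  "('n::finite) point set \<Rightarrow> ('n, 'r::finite) quadratic_map \<Rightarrow> nat \<Rightarrow>
   (nat \<Rightarrow> ('n, 'r) fibre_family) \<Rightarrow> (nat \<Rightarrow> rat) \<Rightarrow> bool" where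
  "critical X Q t F \<alpha> \<equiv> \<not> noncritical X Q t F \<alpha>"

definition k_inv ::
  "('n::finite) point set \<Rightarrow> ('n, 'r::finite) quadratic_map \<Rightarrow> ('n, 'r) fibre_family \<Rightarrow> nat" where
  "k_inv X Q F =
     (if nonzero_on X Q (sub_prod F F) then 2
      else if nonzero_on X Q (sub_prod F whole) then 1 else 0)"

definition delta_semistable ::
  "('n::finite) point set \<Rightarrow> ('n, 'r::finite) atlas \<Rightarrow> ('n, 'r) quadratic_map \<Rightarrow> rat \<Rightarrow> bool" where
  "delta_semistable X E Q \<delta> \<longleftrightarrow>
     (\<forall>t F \<alpha>. weighted_filtration X E t F \<alpha> \<longrightarrow> P_wt X E t F \<alpha> + \<delta> * mu X Q t F \<alpha> \<ge> 0)"

definition delta_stable ::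
  "('n::finite) point set \<Rightarrow> ('n, 'r::finite) atlas \<Rightarrow> ('n, 'r) quadratic_map \<Rightarrow> rat \<Rightarrow> bool" where
  "delta_stable X E Q \<delta> \<longleftrightarrow>
     (\<forall>t F \<alpha>. weighted_filtration X E t F \<alpha> \<longrightarrow> P_wt X E t F \<alpha> + \<delta> * mu X Q t F \<alpha> > 0)"

end

theory Submission
  imports Defs
begin

text \<open>
  Write \<open>A\<^sub>a = \<alpha>\<^sub>a + \<dots> + \<alpha>\<^sub>t\<close>. Then \<open>\<mu>\<close> equals \<open>r\<close> times the maximum of \<open>A\<^sub>a + A\<^sub>b\<close> over the pairs
  \<open>(a, b)\<close> with \<open>Q \<noteq> 0\<close> on \<open>E\<^sub>a E\<^sub>b\<close>, minus \<open>2 (\<Sum> \<alpha>\<^sub>i r\<^sub>i)\<close>, and these pairs form a symmetric up-closed set.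
  If no two indices carrying positive weight form a critical pair \<open>i < j\<close>, the maximum is additive in
  the filtration steps and the inequality for single subbundles suffices. Otherwise one fixes such a
  \<open>j\<close> and the largest \<open>i\<close> that is critical with it, and subtracts the same amount \<open>\<epsilon>\<close> from both weights so
  that one of them vanishes: the maximum drops by at least \<open>2 \<epsilon>\<close>, exactly the contribution of the critical
  filtration \<open>E\<^sub>i \<subset> E\<^sub>j\<close> with weights \<open>\<epsilon>\<close>. Induction on the number of positive weights concludes; strict
  inequalities follow since only finitely many of them are involved.
\<close>

section \<open>Tail sums of weights and their largest value over admissible index pairs\<close>

definition tail :: "nat \<Rightarrow> (nat \<Rightarrow> rat) \<Rightarrow> nat \<Rightarrow> rat" where
  "tail t \<alpha> a = (\<Sum>k=a..t. \<alpha> k)"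

text \<open>\<open>R i j\<close> stands for \<open>Q\<close> being nonzero on
  \<open>E_i E_j\<close>; the index \<open>t+1\<close> is the whole bundle, whose tail is an empty
  sum.\<close>

definition max_tail :: "nat \<Rightarrow> (nat \<Rightarrow> nat \<Rightarrow> bool) \<Rightarrow> (nat \<Rightarrow> rat) \<Rightarrow> rat" where
  "max_tail t R \<alpha> =
     Max {tail t \<alpha> i + tail t \<alpha> j | i j. i \<in> {1..t+1} \<and> j \<in> {1..t+1} \<and> R i j}"

text \<open>The invariant \<open>k_inv\<close> of the \<open>i\<close>-th member, read off from the
  pattern alone.\<close>

definition kappa :: "nat \<Rightarrow> (nat \<Rightarrow> nat \<Rightarrow> bool) \<Rightarrow> nat \<Rightarrow> nat" where
  "kappa t R i = (if R i i then 2 else if R i (Suc t) then 1 else 0)"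

lemma tail_antimono:
  assumes "\<And>k. k \<in> {1..t} \<Longrightarrow> \<alpha> k \<ge> 0" and "1 \<le> a" and "a \<le> b"
  shows "tail t \<alpha> b \<le> tail t \<alpha> a"
  unfolding tail_def using assms by (intro sum_mono2) auto

lemma tail_eq_sum_if: "1 \<le> a \<Longrightarrow> tail t \<alpha> a = (\<Sum>k=1..t. if a \<le> k then \<alpha> k else 0)"
  unfolding tail_def by (intro sum.mono_neutral_cong_left) auto

lemma finite_tail_sums:
  "finite {tail t \<alpha> i + tail t \<alpha> j | i j. i \<in> {1..t+1} \<and> j \<in> {1..t+1} \<and> R i j}"
  by (rule finite_subset[of _ "(\<lambda>(i, j). tail t \<alpha> i + tail t \<alpha> j) ` ({1..t+1} \<times> {1..t+1})"]) auto

lemma max_tail_ge: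
  assumes "R a b" and "a \<in> {1..t+1}" and "b \<in> {1..t+1}"
  shows "tail t \<alpha> a + tail t \<alpha> b \<le> max_tail t R \<alpha>"
  unfolding max_tail_def by (rule Max_ge[OF finite_tail_sums]) (use assms in blast)

section \<open>Symmetric up-closed patterns and the inequality for weighted sums\<close>

locale upset_pattern =
  fixes t :: nat and R :: "nat \<Rightarrow> nat \<Rightarrow> bool"
  assumes sym: "R i j \<Longrightarrow> R j i"
    and mono: "R i j \<Longrightarrow> 1 \<le> i \<Longrightarrow> i \<le> i' \<Longrightarrow> i' \<le> Suc t \<Longrightarrow> R i' j"
    and top: "R (Suc t) (Suc t)"
begin

lemma mono2:
  assumes "R i j" and "1 \<le> i" and "i \<le> i'" and "i' \<le> Suc t" and "1 \<le> j" and "j \<le> j'" and "j' \<le> Suc t"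
  shows "R i' j'"
  using assms mono sym by meson

lemma max_tail_attained:
  obtains a b where "R a b" and "1 \<le> a" and "a \<le> b" and "b \<le> Suc t"
    and "max_tail t R \<alpha> = tail t \<alpha> a + tail t \<alpha> b"
proof -
  let ?S = "{tail t \<alpha> i + tail t \<alpha> j | i j. i \<in> {1..t+1} \<and> j \<in> {1..t+1} \<and> R i j}"
  have "tail t \<alpha> (Suc t) + tail t \<alpha> (Suc t) \<in> ?S" using top by force
  then have "max_tail t R \<alpha> \<in> ?S"
    unfolding max_tail_def by (intro Max_in[OF finite_tail_sums]) auto
  then obtain i j where "max_tail t R \<alpha> = tail t \<alpha> i + tail t \<alpha> j" "i \<in> {1..t+1}" "j \<in> {1..t+1}" "R i j"
    by auto
  then show thesis
    using that[of i j] that[of j i] sym by (cases "i \<le> j") auto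
qed

text \<open>Passing from \<open>\<alpha>'\<close> back to \<open>\<alpha>\<close>, a pair gains
  \<epsilon> for each of its entries and each of \<open>i\<close>, \<open>j\<close> that the entry
  does not exceed. So it suffices to find a pair optimal for \<open>\<alpha>'\<close> that gains at
  least \<open>2 * \<epsilon>\<close>. The premise \<open>maximal\<close> allows the larger entry to
  be lowered to \<open>j\<close> when the smaller one lies strictly between \<open>i\<close> and
  \<open>j\<close>.\<close>

lemma max_tail_reduce:
  assumes nonneg: "\<And>k. k \<in> {1..t} \<Longrightarrow> \<alpha> k \<ge> 0"
    and i: "i \<in> {1..t}" and j: "j \<in> {1..t}"
    and \<epsilon>: "0 \<le> \<epsilon>" "\<epsilon> \<le> \<alpha> i" "\<epsilon> \<le> \<alpha> j"
    and jj: "R j j" and ij: "\<not> R i j"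
    and maximal: "\<And>c. i < c \<Longrightarrow> c < j \<Longrightarrow> \<alpha> c > 0 \<Longrightarrow> R c (Suc t) \<Longrightarrow> R c j"
  defines "\<alpha>' \<equiv> \<lambda>k. if k = i \<or> k = j then \<alpha> k - \<epsilon> else \<alpha> k"
  shows "max_tail t R \<alpha>' + 2 * \<epsilon> \<le> max_tail t R \<alpha>"
proof -
  have lt: "i < j"
    using jj ij i j mono[of j j i] by (cases "i < j") auto
  have \<alpha>'_nonneg: "\<And>k. k \<in> {1..t} \<Longrightarrow> \<alpha>' k \<ge> 0"
    using nonneg \<epsilon> by (auto simp: \<alpha>'_def)
  have tail_split: "tail t \<alpha> a = tail t \<alpha>' a + \<epsilon> * (of_bool (a \<le> i) + of_bool (a \<le> j))"
    if "1 \<le> a" for a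
  proof -
    have "tail t \<alpha> a = (\<Sum>k=1..t. (if a \<le> k then \<alpha>' k else 0)
        + (if k = i then \<epsilon> * of_bool (a \<le> i) else 0) + (if k = j then \<epsilon> * of_bool (a \<le> j) else 0))"
      unfolding tail_eq_sum_if[OF that] using lt by (intro sum.cong) (auto simp: \<alpha>'_def)
    also have "\<dots> = tail t \<alpha>' a + \<epsilon> * of_bool (a \<le> i) + \<epsilon> * of_bool (a \<le> j)"
      unfolding tail_eq_sum_if[OF that] sum.distrib using i j by simp
    finally show ?thesis by (simp add: algebra_simps)
  qed
  obtain a b where ab: "R a b" "1 \<le> a" "a \<le> b" "b \<le> Suc t"
    and opt: "max_tail t R \<alpha>' = tail t \<alpha>' a + tail t \<alpha>' b"
    using max_tail_attained by blast
  \<comment> \<open>An optimal pair for \<open>\<alpha>'\<close> may gain only \<open>0\<close> or \<open>\<epsilon>\<close> when passing to \<open>\<alpha>\<close>; then another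
     optimal pair, both of whose entries are at most \<open>j\<close>, gains \<open>2\<epsilon>\<close>.\<close>
  have "\<exists>c e. R c e \<and> c \<in> {1..t+1} \<and> e \<in> {1..t+1}
      \<and> tail t \<alpha>' a + tail t \<alpha>' b \<le> tail t \<alpha>' c + tail t \<alpha>' e
      \<and> ((c \<le> j \<and> e \<le> j) \<or> (c \<le> i \<and> c \<le> j))"
  \<comment> \<open>If \<open>b \<le> j\<close>, both entries are at most \<open>j\<close>; if
    \<open>a \<le> i\<close>, the entry \<open>a\<close> alone gains twice. Either way
    \<open>(a, b)\<close> itself serves.\<close>
  proof (cases "b \<le> j \<or> a \<le> i")
    case True
    then show ?thesis using ab lt by (intro exI[of _ a] exI[of _ b]) auto
  next
    case False
    show ?thesis
    proof (cases "a < j")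
      case True
      \<comment> \<open>The weights \<open>\<alpha>'\<close> vanish from \<open>a\<close> up to just
        before \<open>c\<close>, so \<open>a\<close> may be moved to \<open>c\<close> at no cost.
        Then \<open>c\<close> either is \<open>j\<close> or carries positive weight strictly between
        \<open>i\<close> and \<open>j\<close>, where \<open>maximal\<close> gives
        \<open>R c j\<close>.\<close>
      define c where "c = (LEAST c. a \<le> c \<and> (\<alpha> c > 0 \<or> c = j))"
      have c: "a \<le> c \<and> (\<alpha> c > 0 \<or> c = j)"
        unfolding c_def by (rule LeastI[of _ j]) (use True in auto)
      have c_min: "c \<le> k" if "a \<le> k" "\<alpha> k > 0 \<or> k = j" for k
        unfolding c_def using that by (intro Least_le) auto
      have cj: "c \<le> j" using c_min True by auto
      have "R c j"
      proof (cases "c = j")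
        case False
        then show ?thesis
          using maximal[of c] mono2[OF ab(1), of c "Suc t"] c cj \<open>\<not> (b \<le> j \<or> a \<le> i)\<close> ab j by auto
      qed (use jj in simp)
      moreover have "tail t \<alpha>' a = tail t \<alpha>' c"
        unfolding tail_def
      proof (rule sum.mono_neutral_right)
        show "\<forall>k\<in>{a..t} - {c..t}. \<alpha>' k = 0"
        proof
          fix k assume k: "k \<in> {a..t} - {c..t}"
          then have "\<not> \<alpha> k > 0" "k \<noteq> j" using c_min[of k] by auto
          moreover have "\<alpha> k \<ge> 0" "k \<noteq> i" using nonneg k ab False by auto
          ultimately show "\<alpha>' k = 0" by (simp add: \<alpha>'_def)
        qed
      qed (use c in auto)
      moreover have "tail t \<alpha>' b \<le> tail t \<alpha>' j"
        using False j by (intro tail_antimono[OF \<alpha>'_nonneg]) auto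
      ultimately show ?thesis
        using c cj ab j by (intro exI[of _ c] exI[of _ j]) auto
    next
      case False': False
      \<comment> \<open>Both entries are at least \<open>j\<close> here, so lowering both to
        \<open>j\<close> cannot decrease the tails.\<close>
      then have "tail t \<alpha>' b \<le> tail t \<alpha>' j" "tail t \<alpha>' a \<le> tail t \<alpha>' j"
        using False j by (auto intro!: tail_antimono[OF \<alpha>'_nonneg])
      then show ?thesis
        using jj j by (intro exI[of _ j]) auto
    qed
  qed
  then obtain c e where ce: "R c e" "c \<in> {1..t+1}" "e \<in> {1..t+1}"
      "max_tail t R \<alpha>' \<le> tail t \<alpha>' c + tail t \<alpha>' e" "(c \<le> j \<and> e \<le> j) \<or> (c \<le> i \<and> c \<le> j)"
    unfolding opt by auto
  have "2 * \<epsilon> \<le> \<epsilon> * (of_bool (c \<le> i) + of_bool (c \<le> j)) + \<epsilon> * (of_bool (e \<le> i) + of_bool (e \<le> j))"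
    using ce(5) \<epsilon>(1) by (auto simp: algebra_simps)
  then have "max_tail t R \<alpha>' + 2 * \<epsilon> \<le> tail t \<alpha> c + tail t \<alpha> e"
    using ce tail_split[of c] tail_split[of e] by simp
  also have "\<dots> \<le> max_tail t R \<alpha>"
    using ce by (intro max_tail_ge)
  finally show ?thesis .
qed

text \<open>The first positively weighted index \<open>a\<close> with \<open>R a (Suc t)\<close> and
  the first such \<open>b\<close> with \<open>R b b\<close> form an admissible pair by
  \<open>no_pair\<close>. An index with \<open>kappa\<close> 1 is counted in the tail of
  \<open>a\<close>, one with \<open>kappa\<close> 2 in both tails.\<close>

lemma max_tail_ge_kappa:
  assumes nonneg: "\<And>k. k \<in> {1..t} \<Longrightarrow> \<alpha> k \<ge> 0"
    and no_pair: "\<And>i j. i \<in> {1..t} \<Longrightarrow> j \<in> {1..t} \<Longrightarrow> \<alpha> i > 0 \<Longrightarrow> \<alpha> j > 0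
        \<Longrightarrow> R i (Suc t) \<Longrightarrow> R j j \<Longrightarrow> R i j"
  shows "(\<Sum>i=1..t. \<alpha> i * of_nat (kappa t R i)) \<le> max_tail t R \<alpha>"
proof -
  \<comment> \<open>The default \<open>Suc t\<close>, whose tail is 0, covers the absence of such an
    index.\<close>
  define a where "a = (LEAST i. 1 \<le> i \<and> (i = Suc t \<or> (i \<le> t \<and> \<alpha> i > 0 \<and> R i (Suc t))))"
  define b where "b = (LEAST i. 1 \<le> i \<and> (i = Suc t \<or> (i \<le> t \<and> \<alpha> i > 0 \<and> R i i)))"
  have a: "1 \<le> a \<and> (a = Suc t \<or> (a \<le> t \<and> \<alpha> a > 0 \<and> R a (Suc t)))"
    unfolding a_def by (rule LeastI[of _ "Suc t"]) auto
  have b: "1 \<le> b \<and> (b = Suc t \<or> (b \<le> t \<and> \<alpha> b > 0 \<and> R b b))"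
    unfolding b_def by (rule LeastI[of _ "Suc t"]) auto
  have a_min: "a \<le> i" if "i \<in> {1..t}" "\<alpha> i > 0" "R i (Suc t)" for i
    unfolding a_def using that by (intro Least_le) auto
  have b_min: "b \<le> i" if "i \<in> {1..t}" "\<alpha> i > 0" "R i i" for i
    unfolding b_def using that by (intro Least_le) auto
  have "R a b"
  proof (cases "a = Suc t")
    case True
    then show ?thesis using top b mono2[of b b "Suc t" b] by auto
  next
    case False
    then show ?thesis using a b no_pair[of a b] by auto
  qed
  have "(\<Sum>i=1..t. \<alpha> i * of_nat (kappa t R i))
      \<le> (\<Sum>i=1..t. (if a \<le> i then \<alpha> i else 0) + (if b \<le> i then \<alpha> i else 0))"
  proof (rule sum_mono)
    fix i assume i: "i \<in> {1..t}"
    show "\<alpha> i * of_nat (kappa t R i) \<le> (if a \<le> i then \<alpha> i else 0) + (if b \<le> i then \<alpha> i else 0)"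
    proof (cases "\<alpha> i > 0")
      case True
      have "R i (Suc t)" if "R i i" using mono2[OF that, of i "Suc t"] i by auto
      then show ?thesis
        using a_min[OF i True] b_min[OF i True] True by (auto simp: kappa_def)
    next
      case False
      then have "\<alpha> i = 0" using nonneg[OF i] by simp
      then show ?thesis by simp
    qed
  qed
  also have "\<dots> = tail t \<alpha> a + tail t \<alpha> b"
    using a b by (simp add: tail_eq_sum_if sum.distrib)
  also have "\<dots> \<le> max_tail t R \<alpha>"
    using \<open>R a b\<close> a b by (intro max_tail_ge) auto
  finally show ?thesis .
qed

lemma weighted_sum_nonneg:
  fixes w :: "nat \<Rightarrow> rat" and D :: rat
  assumes D: "D \<ge> 0"
    and single: "\<And>i. i \<in> {1..t} \<Longrightarrow> w i + D * of_nat (kappa t R i) \<ge> 0"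
    and pair: "\<And>i j. i \<in> {1..t} \<Longrightarrow> j \<in> {1..t} \<Longrightarrow> i < j \<Longrightarrow> R i (Suc t) \<Longrightarrow> R j j \<Longrightarrow> \<not> R i j
        \<Longrightarrow> w i + w j + 2 * D \<ge> 0"
    and nonneg: "\<And>k. k \<in> {1..t} \<Longrightarrow> \<alpha> k \<ge> 0"
  shows "(\<Sum>i=1..t. \<alpha> i * w i) + D * max_tail t R \<alpha> \<ge> 0"
  using nonneg
proof (induction "card {k \<in> {1..t}. \<alpha> k > 0}" arbitrary: \<alpha> rule: less_induct)
  case less
  show ?case
  proof (cases "\<exists>i j. i \<in> {1..t} \<and> j \<in> {1..t} \<and> \<alpha> i > 0 \<and> \<alpha> j > 0 \<and> R i (Suc t) \<and> R j j \<and> \<not> R i j")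
    case False
    have "0 \<le> (\<Sum>i=1..t. \<alpha> i * (w i + D * of_nat (kappa t R i)))"
      using less.prems single by (intro sum_nonneg mult_nonneg_nonneg) auto
    also have "\<dots> = (\<Sum>i=1..t. \<alpha> i * w i) + D * (\<Sum>i=1..t. \<alpha> i * of_nat (kappa t R i))"
      by (simp add: sum.distrib sum_distrib_left algebra_simps)
    also have "\<dots> \<le> (\<Sum>i=1..t. \<alpha> i * w i) + D * max_tail t R \<alpha>"
      using D False less.prems by (intro add_left_mono mult_left_mono max_tail_ge_kappa) blast+
    finally show ?thesis .
  next
    case True
    then obtain i0 j where j: "j \<in> {1..t}" "\<alpha> j > 0" "R j j"
      and i0: "i0 \<in> {1..t}" "\<alpha> i0 > 0" "R i0 (Suc t)" "\<not> R i0 j"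
      by blast
    define S where "S = {i \<in> {1..t}. \<alpha> i > 0 \<and> R i (Suc t) \<and> \<not> R i j}"
    have S: "finite S" "S \<noteq> {}" using i0 by (auto simp: S_def)
    \<comment> \<open>Taking the largest element keeps every \<open>c\<close> strictly between
      \<open>i\<close> and \<open>j\<close> out of \<open>S\<close>, which supplies the premise
      \<open>maximal\<close> of the reduction.\<close>
    define i where "i = Max S"
    have "i \<in> S" unfolding i_def by (rule Max_in[OF S])
    then have i: "i \<in> {1..t}" "\<alpha> i > 0" "R i (Suc t)" "\<not> R i j" by (auto simp: S_def)
    have lt: "i < j"
      using j i mono[of j j i] by (cases "i < j") auto
    define \<epsilon> where "\<epsilon> = min (\<alpha> i) (\<alpha> j)"
    have \<epsilon>: "0 < \<epsilon>" "\<epsilon> \<le> \<alpha> i" "\<epsilon> \<le> \<alpha> j" using i j by (auto simp: \<epsilon>_def)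
    define \<alpha>' where "\<alpha>' = (\<lambda>k. if k = i \<or> k = j then \<alpha> k - \<epsilon> else \<alpha> k)"
    have \<alpha>'_nonneg: "\<And>k. k \<in> {1..t} \<Longrightarrow> \<alpha>' k \<ge> 0"
      using less.prems \<epsilon> by (auto simp: \<alpha>'_def)
    \<comment> \<open>The smaller of the two weights becomes 0, so the number of positive weights
      drops.\<close>
    have "\<alpha>' i = 0 \<or> \<alpha>' j = 0" by (auto simp: \<alpha>'_def \<epsilon>_def min_def)
    then have "{k \<in> {1..t}. \<alpha>' k > 0} \<subset> {k \<in> {1..t}. \<alpha> k > 0}"
      using i j \<epsilon> by (auto simp: \<alpha>'_def split: if_splits)
    then have IH: "(\<Sum>k=1..t. \<alpha>' k * w k) + D * max_tail t R \<alpha>' \<ge> 0"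
      by (intro less.hyps \<alpha>'_nonneg psubset_card_mono) auto
    have "max_tail t R \<alpha>' + 2 * \<epsilon> \<le> max_tail t R \<alpha>"
      unfolding \<alpha>'_def
    proof (rule max_tail_reduce[OF less.prems i(1) j(1) _ \<epsilon>(2,3) j(3) i(4)])
      fix c assume c: "i < c" "c < j" "\<alpha> c > 0" "R c (Suc t)"
      then have "c \<notin> S" using Max_ge[OF S(1), of c] by (auto simp: i_def)
      then show "R c j" using c i j by (auto simp: S_def)
    qed (use \<epsilon> in auto)
    then have "D * max_tail t R \<alpha>' + \<epsilon> * (2 * D) \<le> D * max_tail t R \<alpha>"
      using mult_left_mono[OF _ D] by (fastforce simp: algebra_simps)
    \<comment> \<open>The removed weights account for \<open>\<epsilon> * (w i + w j)\<close> and
      the maximum drops by at least \<open>2 * \<epsilon>\<close>, so the pair condition scaled by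
      \<epsilon> closes the gap.\<close>
    moreover have "\<epsilon> * (w i + w j + 2 * D) \<ge> 0"
      using pair[OF i(1) j(1) lt i(3) j(3) i(4)] \<epsilon> by simp
    moreover have "(\<Sum>k=1..t. \<alpha> k * w k) = (\<Sum>k=1..t. \<alpha>' k * w k
        + (if k = i then \<epsilon> * w i else 0) + (if k = j then \<epsilon> * w j else 0))"
      using lt by (intro sum.cong) (auto simp: \<alpha>'_def algebra_simps)
    then have "(\<Sum>k=1..t. \<alpha> k * w k) = (\<Sum>k=1..t. \<alpha>' k * w k) + \<epsilon> * w i + \<epsilon> * w j"
      unfolding sum.distrib using i j by simp
    ultimately show ?thesis using IH by (simp add: algebra_simps)
  qed
qed

text \<open>Finitely many positive quantities have a positive minimum \<open>e\<close>. Lowering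
  every \<open>w i\<close> by \<open>e / 2\<close> costs \<open>e / 2\<close> in each single
  condition and \<open>e\<close> in each pair condition, so the weak inequality still applies and
  leaves a surplus of \<open>e / 2\<close> times the total weight.\<close>

lemma weighted_sum_pos:
  fixes w :: "nat \<Rightarrow> rat" and D :: rat
  assumes D: "D \<ge> 0"
    and single: "\<And>i. i \<in> {1..t} \<Longrightarrow> w i + D * of_nat (kappa t R i) > 0"
    and pair: "\<And>i j. i \<in> {1..t} \<Longrightarrow> j \<in> {1..t} \<Longrightarrow> i < j \<Longrightarrow> R i (Suc t) \<Longrightarrow> R j j \<Longrightarrow> \<not> R i j
        \<Longrightarrow> w i + w j + 2 * D > 0"
    and t: "t \<ge> 1" and pos: "\<And>k. k \<in> {1..t} \<Longrightarrow> \<alpha> k > 0"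
  shows "(\<Sum>i=1..t. \<alpha> i * w i) + D * max_tail t R \<alpha> > 0"
proof -
  \<comment> \<open>The element 1 keeps \<open>V\<close> nonempty, as \<open>Min\<close>
    requires.\<close>
  define V where "V = insert 1 ((\<lambda>i. w i + D * of_nat (kappa t R i)) ` {1..t} \<union>
    (\<lambda>(i, j). w i + w j + 2 * D) ` {(i, j) \<in> {1..t} \<times> {1..t}. i < j \<and> R i (Suc t) \<and> R j j \<and> \<not> R i j})"
  have "finite {(i, j) \<in> {1..t} \<times> {1..t}. i < j \<and> R i (Suc t) \<and> R j j \<and> \<not> R i j}"
    by (rule finite_subset[of _ "{1..t} \<times> {1..t}"]) auto
  then have fin: "finite V" unfolding V_def by simp
  define e where "e = Min V"
  have "e > 0"
    unfolding e_def using single pair fin by (subst Min_gr_iff) (auto simp: V_def)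
  have e: "e \<le> v" if "v \<in> V" for v
    unfolding e_def using fin that by simp
  have "(\<Sum>i=1..t. \<alpha> i * (w i - e / 2)) + D * max_tail t R \<alpha> \<ge> 0"
  proof (rule weighted_sum_nonneg[OF D])
    fix i assume "i \<in> {1..t}"
    then have "e \<le> w i + D * of_nat (kappa t R i)" by (intro e) (auto simp: V_def)
    then show "w i - e / 2 + D * of_nat (kappa t R i) \<ge> 0" using \<open>e > 0\<close> by simp
  next
    fix i j assume "i \<in> {1..t}" "j \<in> {1..t}" "i < j" "R i (Suc t)" "R j j" "\<not> R i j"
    then have "e \<le> w i + w j + 2 * D" by (intro e) (force simp: V_def)
    then show "w i - e / 2 + (w j - e / 2) + 2 * D \<ge> 0" by simp
  qed (use pos in \<open>auto intro: less_imp_le\<close>)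
  moreover have "(\<Sum>i=1..t. \<alpha> i * (w i - e / 2)) = (\<Sum>i=1..t. \<alpha> i * w i) - e / 2 * (\<Sum>i=1..t. \<alpha> i)"
    by (simp add: sum_distrib_left sum_subtractf algebra_simps)
  moreover have "(\<Sum>i=1..t. \<alpha> i) > 0"
    using t pos by (intro sum_pos) auto
  then have "e / 2 * (\<Sum>i=1..t. \<alpha> i) > 0" using \<open>e > 0\<close> by simp
  ultimately show ?thesis by linarith
qed

end

section \<open>The maximum for filtrations of length one and two\<close>

lemma max_tail_1:
  assumes "upset_pattern 1 R" and "\<alpha> 1 \<ge> 0"
  shows "max_tail 1 R \<alpha> = \<alpha> 1 * of_nat (kappa 1 R 1)"
proof -
  interpret upset_pattern 1 R by fact
  obtain a b where ab: "R a b" "1 \<le> a" "a \<le> b" "b \<le> Suc 1"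
    and eq: "max_tail 1 R \<alpha> = tail 1 \<alpha> a + tail 1 \<alpha> b"
    using max_tail_attained by blast
  have "max_tail 1 R \<alpha> \<le> \<alpha> 1 * of_nat (kappa 1 R 1)"
    using ab assms(2) mono2[of a b a 2] unfolding eq
    by (cases "a = 1"; cases "b = 1") (auto simp: tail_def kappa_def numeral_2_eq_2 le_Suc_eq)
  moreover have "\<alpha> 1 * of_nat (kappa 1 R 1) \<le> max_tail 1 R \<alpha>"
    using max_tail_ge_kappa[of \<alpha>] assms(2) by (simp add: le_antisym)
  ultimately show ?thesis by simp
qed

text \<open>Unit weights give the tails 2, 1, 0. In the exceptional pattern the best pairs
  \<open>(1, 3)\<close> and \<open>(2, 2)\<close> reach only 2, while the values of
  \<open>kappa\<close> are 1 and 2; this deficit is what criticality detects.\<close>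

lemma max_tail_2_cases:
  assumes "upset_pattern 2 R"
  shows "max_tail 2 R (\<lambda>_. 1) =
    (if R 1 3 \<and> R 2 2 \<and> \<not> R 1 2 then 2 else of_nat (kappa 2 R 1 + kappa 2 R 2))"
proof -
  interpret upset_pattern 2 R by fact
  have tl: "tail 2 (\<lambda>_. 1) (Suc 0) = 2" "tail 2 (\<lambda>_. 1) 2 = 1" "tail 2 (\<lambda>_. 1) 3 = 0"
    by (auto simp: tail_def)
  have up: "R 1 1 \<Longrightarrow> R 1 2" "R 1 2 \<Longrightarrow> R 1 3" "R 1 2 \<Longrightarrow> R 2 2" "R 2 2 \<Longrightarrow> R 2 3" "R 1 3 \<Longrightarrow> R 2 3" "R 3 3"
    using mono2[of 1 1 1 2] mono2[of 1 2 1 3] mono2[of 1 2 2 2] mono2[of 2 2 2 3] mono2[of 1 3 2 3] top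
    by auto
  obtain a b where ab: "R a b" "1 \<le> a" "a \<le> b" "b \<le> Suc 2"
    and eq: "max_tail 2 R (\<lambda>_. 1) = tail 2 (\<lambda>_. 1) a + tail 2 (\<lambda>_. 1) b"
    using max_tail_attained by blast
  have "a = 1 \<or> a = 2 \<or> a = 3" "b = 1 \<or> b = 2 \<or> b = 3" using ab by auto
  then have "max_tail 2 R (\<lambda>_. 1) \<le>
      (if R 1 3 \<and> R 2 2 \<and> \<not> R 1 2 then 2 else of_nat (kappa 2 R 1 + kappa 2 R 2))"
    using ab(1,3) up unfolding eq by (auto simp: tl kappa_def)
  moreover have "(if R 1 3 \<and> R 2 2 \<and> \<not> R 1 2 then 2 else of_nat (kappa 2 R 1 + kappa 2 R 2))
      \<le> max_tail 2 R (\<lambda>_. 1)"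
    using max_tail_ge[of R 1 1 2 "\<lambda>_. 1"] max_tail_ge[of R 1 2 2 "\<lambda>_. 1"] max_tail_ge[of R 1 3 2 "\<lambda>_. 1"]
      max_tail_ge[of R 2 2 2 "\<lambda>_. 1"] max_tail_ge[of R 2 3 2 "\<lambda>_. 1"] max_tail_ge[of R 3 3 2 "\<lambda>_. 1"] up
    by (auto simp: tl kappa_def)
  ultimately show ?thesis by simp
qed

section \<open>Products of fibre families and non-vanishing of \<open>Q\<close>\<close>

lemma strict_sub_trans: "strict_sub X F G \<Longrightarrow> strict_sub X G H \<Longrightarrow> strict_sub X F H"
  unfolding strict_sub_def by (metis subset_antisym subset_trans)

lemma sym_prod_commute: "sym_prod a b = sym_prod b a"
  unfolding sym_prod_def by (simp add: algebra_simps)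

lemma sub_prod_commute: "sub_prod A B = sub_prod B A"
  unfolding sub_prod_def by (rule ext, rule arg_cong[where f = vec.span]) (use sym_prod_commute in blast)

lemma nonzero_on_sub_prod_mono:
  assumes "nonzero_on X Q (sub_prod A B)" and "\<And>p. p \<in> X \<Longrightarrow> A p \<subseteq> A' p"
  shows "nonzero_on X Q (sub_prod A' B)"
proof -
  have "sub_prod A B p \<subseteq> sub_prod A' B p" if "p \<in> X" for p
    unfolding sub_prod_def using assms(2)[OF that] by (intro vec.span_mono) blast
  then show ?thesis using assms(1) unfolding nonzero_on_def by blast
qed

text \<open>A symmetric tensor is the combination of products of basis vectors with its own entries
  as coefficients, each product contributing one half at \<open>(i, j)\<close> and one half at
  \<open>(j, i)\<close>. Hence \<open>Q\<close> is nonzero on the product of the whole bundle with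
  itself.\<close>

lemma Sym2_subset_sub_prod_whole: "Sym2 p \<subseteq> sub_prod whole whole p"
proof
  fix w :: "complex ^ ('r::finite \<times> 'r)"
  assume "w \<in> Sym2 p"
  then have symm: "w $ (j, i) = w $ (i, j)" for i j by (simp add: Sym2_def)
  have "w = (\<Sum>i\<in>UNIV. \<Sum>j\<in>UNIV. w $ (i, j) *s sym_prod (axis i 1) (axis j 1))"
  proof (subst vec_eq_iff, rule allI)
    fix kl :: "'r \<times> 'r"
    obtain k l where kl: "kl = (k, l)" by (cases kl)
    have "(\<Sum>i\<in>UNIV. \<Sum>j\<in>UNIV. w $ (i, j) *s sym_prod (axis i 1) (axis j 1)) $ kl
        = (\<Sum>i\<in>UNIV. \<Sum>j\<in>UNIV. (if i = k then if j = l then w $ (i, j) / 2 else 0 else 0)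
            + (if i = l then if j = k then w $ (i, j) / 2 else 0 else 0))"
      unfolding kl sum_component sym_prod_def by (intro sum.cong) (auto simp: axis_def)
    also have "\<dots> = w $ (k, l) / 2 + w $ (l, k) / 2"
      unfolding sum.distrib by (simp add: if_distrib[of "sum _"] sum.If_cases flip: if_distribR)
    also have "\<dots> = w $ kl" using symm kl by simp
    finally show "w $ kl = (\<Sum>i\<in>UNIV. \<Sum>j\<in>UNIV. w $ (i, j) *s sym_prod (axis i 1) (axis j 1)) $ kl" ..
  qed
  also have "\<dots> \<in> sub_prod whole whole p"
    unfolding sub_prod_def whole_def
    by (intro vec.span_sum vec.span_scale vec.span_base) blast
  finally show "w \<in> sub_prod whole whole p" .
qed

section \<open>Ranks and members of filtrations\<close>

locale nonzero_quadric =
  fixes X :: "('n::finite) point set" and E :: "('n, 'r::finite) atlas" and Q :: "('n, 'r) quadratic_map"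
  assumes nonempty: "X \<noteq> {}" and nonzero: "nonzero_on X Q Sym2"
begin

lemma rk_eqI: "(\<And>p. p \<in> X \<Longrightarrow> vec.dim (F p) = k) \<Longrightarrow> rk X F = k"
  unfolding rk_def using nonempty by (intro the_equality) auto

lemma subbundle_fibre:
  assumes "subbundle X E F" and "p \<in> X"
  shows "vec.subspace (F p)" and "vec.dim (F p) = rk X F"
proof -
  obtain k where k: "\<And>p. p \<in> X \<Longrightarrow> \<exists>U s. p \<in> U \<and> is_frame X E F U k s"
    using assms(1) unfolding subbundle_def by blast
  have fibre: "vec.subspace (F p) \<and> vec.dim (F p) = k" if p: "p \<in> X" for p
  proof -
    obtain U s where "p \<in> U" "is_frame X E F U k s" using k[OF p] by blast
    then have s: "inj_on (\<lambda>i. s i p) {..<k}" "vec.independent ((\<lambda>i. s i p) ` {..<k})"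
        "vec.span ((\<lambda>i. s i p) ` {..<k}) = F p"
      unfolding is_frame_def by blast+
    show ?thesis
      using vec.dim_span_eq_card_independent[OF s(2)] card_image[OF s(1)] s(3) vec.subspace_span
      by (metis card_lessThan)
  qed
  then have "rk X F = k" by (intro rk_eqI) blast
  then show "vec.subspace (F p)" and "vec.dim (F p) = rk X F" using fibre assms(2) by auto
qed

lemma rk_whole: "rk X (whole :: ('n, 'r) fibre_family) = CARD('r)"
  by (rule rk_eqI) (simp add: whole_def card_cart_basis)

text \<open>Strictness is witnessed at one point only; since fibre dimensions are constant, the
  comparison at that point decides.\<close>

lemma strict_sub_dim_less:
  assumes "strict_sub X F G"
    and "\<And>p. p \<in> X \<Longrightarrow> vec.subspace (F p) \<and> vec.dim (F p) = k"
    and "\<And>p. p \<in> X \<Longrightarrow> vec.subspace (G p) \<and> vec.dim (G p) = l"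
  shows "k < l"
proof -
  obtain p where "p \<in> X" "F p \<subseteq> G p" "F p \<noteq> G p" using assms(1) by (auto simp: strict_sub_def)
  then show ?thesis
    using assms(2,3)[of p] vec.subspace_dim_equal[of "F p" "G p"] by (metis not_le)
qed

lemma rk_pos:
  assumes "subbundle X E F" and "strict_sub X zero_sub F"
  shows "rk X F > 0"
proof (rule strict_sub_dim_less[OF assms(2), where k = 0])
  show "vec.subspace (zero_sub p :: (complex ^ 'r) set) \<and> vec.dim (zero_sub p :: (complex ^ 'r) set) = 0" for p :: "'n point"
    by (simp add: zero_sub_def vec.subspace_0 vec.subspace_single_0)
qed (use assms(1) subbundle_fibre in auto)

lemma step_fibre:
  assumes "filtration X E t F" and "1 \<le> i" and "i \<le> Suc t" and "p \<in> X"
  shows "vec.subspace (step t F i p) \<and> vec.dim (step t F i p) = rk X (step t F i)"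
proof (cases "i = Suc t")
  case True
  then show ?thesis using rk_whole by (simp add: step_def whole_def card_cart_basis)
next
  case False
  then have "subbundle X E (F i)" using assms by (auto simp: filtration_def)
  then show ?thesis using subbundle_fibre assms(4) False by (simp add: step_def)
qed

lemma step_strict_sub:
  assumes "filtration X E t F" and "1 \<le> i" and "i < j" and "j \<le> Suc t"
  shows "strict_sub X (step t F i) (step t F j)"
  using assms(3,4)
proof (induction j)
  case (Suc j)
  have step: "strict_sub X (step t F j) (step t F (Suc j))"
    using Suc.prems assms(1,2) by (auto simp: filtration_def)
  show ?case
  proof (cases "i = j")
    case False
    then show ?thesis using Suc strict_sub_trans[OF _ step] by auto
  qed (use step in simp)
qed simp

text \<open>Strict growth of the ranks turns the comparison of ranks in \<open>gamma_vec\<close>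
  into a comparison of indices.\<close>

lemma step_rk_less:
  assumes "filtration X E t F" and "1 \<le> i" and "i < j" and "j \<le> Suc t"
  shows "rk X (step t F i) < rk X (step t F j)"
  by (rule strict_sub_dim_less[OF step_strict_sub[OF assms]])
    (use step_fibre[OF assms(1)] assms(2-4) in auto)

lemma filtration_member:
  assumes "filtration X E t F" and "i \<in> {1..t}"
  shows "subbundle X E (F i)" and "strict_sub X zero_sub (F i)" and "strict_sub X (F i) whole"
proof -
  show "subbundle X E (F i)" using assms by (auto simp: filtration_def)
  have "strict_sub X zero_sub (F 1)" using assms by (auto simp: filtration_def)
  moreover have "strict_sub X (F 1) (F i)" if "1 < i"
    using step_strict_sub[OF assms(1) _ that] assms(2) by (simp add: step_def)
  ultimately show "strict_sub X zero_sub (F i)"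
    using strict_sub_trans assms(2) by (cases "i = 1") auto
  show "strict_sub X (F i) whole"
    using step_strict_sub[OF assms(1), of i "Suc t"] assms(2) by (simp add: step_def)
qed

lemma filtration_1:
  assumes "subbundle X E F" and "strict_sub X zero_sub F" and "strict_sub X F whole"
  shows "filtration X E 1 (\<lambda>_. F)"
  using assms by (auto simp: filtration_def step_def)

text \<open>Brings two members of a longer filtration into the shape that condition (2) speaks
  of.\<close>

lemma filtration_pair:
  assumes "filtration X E t F" and "i \<in> {1..t}" and "j \<in> {1..t}" and "i < j"
  shows "filtration X E 2 (\<lambda>k. if k = 1 then F i else F j)"
proof -
  have "strict_sub X (F i) (F j)"
    using step_strict_sub[OF assms(1), of i j] assms by (simp add: step_def)
  moreover have "{1..2::nat} = {1, 2}" by auto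
  ultimately show ?thesis
    using filtration_member[OF assms(1,2)] filtration_member[OF assms(1,3)]
    by (simp add: filtration_def step_def eval_nat_numeral)
qed

section \<open>The invariant \<open>mu\<close> in terms of tails, and critical filtrations\<close>

abbreviation nonvanishing :: "nat \<Rightarrow> (nat \<Rightarrow> ('n, 'r) fibre_family) \<Rightarrow> nat \<Rightarrow> nat \<Rightarrow> bool" where
  "nonvanishing t F i j \<equiv> nonzero_on X Q (sub_prod (step t F i) (step t F j))"

text \<open>Symmetry comes from commutativity of products, up-closure from the inclusions in the
  chain, and the top pair from \<open>Q\<close> being nonzero.\<close>

lemma upset_pattern_nonvanishing:
  assumes "filtration X E t F"
  shows "upset_pattern t (nonvanishing t F)"
proof
  fix i j i'
  show "nonvanishing t F i j \<Longrightarrow> nonvanishing t F j i" by (simp add: sub_prod_commute)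
  assume "nonvanishing t F i j" "1 \<le> i" "i \<le> i'" "i' \<le> Suc t"
  moreover have "step t F i p \<subseteq> step t F i' p" if "p \<in> X" for p
    using step_strict_sub[OF assms, of i i'] calculation that
    by (cases "i = i'") (auto simp: strict_sub_def)
  ultimately show "nonvanishing t F i' j" using nonzero_on_sub_prod_mono by blast
next
  show "nonvanishing t F (Suc t) (Suc t)"
    using nonzero Sym2_subset_sub_prod_whole unfolding nonzero_on_def step_def by fastforce
qed

lemma kappa_nonvanishing:
  "i \<in> {1..t} \<Longrightarrow> kappa t (nonvanishing t F) i = k_inv X Q (F i)"
  by (auto simp: kappa_def k_inv_def step_def)

text \<open>The entry numbered by the rank of the \<open>i\<close>-th step receives the extra
  summand \<open>- \<alpha> k * r\<close> exactly from those \<open>k\<close> whose rank is at least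
  as large, that is, from \<open>k\<close> with \<open>i \<le> k\<close>.\<close>

lemma gamma_eq:
  assumes "filtration X E t F" and "i \<in> {1..t+1}"
  shows "gamma X t F \<alpha> i = (\<Sum>k=1..t. \<alpha> k * of_nat (rk X (F k))) - of_nat CARD('r) * tail t \<alpha> i"
proof -
  have "rk X (step t F i) \<le> rk X (F k) \<longleftrightarrow> i \<le> k" if "k \<in> {1..t}" for k
  proof -
    have "step t F k = F k" using that by (simp add: step_def)
    then show ?thesis
      using step_rk_less[OF assms(1), of i k] step_rk_less[OF assms(1), of k i] that assms(2)
      by (cases i k rule: linorder_cases) auto
  qed
  then have "gamma X t F \<alpha> i = (\<Sum>k=1..t. \<alpha> k * of_nat (rk X (F k))
      - of_nat CARD('r) * (if i \<le> k then \<alpha> k else 0))"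
    unfolding gamma_def gamma_vec_def by (intro sum.cong) (auto simp: algebra_simps)
  then show ?thesis
    using assms(2) by (simp add: sum_subtractf tail_eq_sum_if sum_distrib_left)
qed

text \<open>All entries share the same constant, so minimising their sum over admissible pairs
  amounts to maximising the sum of tails.\<close>

lemma mu_eq:
  assumes "filtration X E t F"
  shows "mu X Q t F \<alpha> = of_nat CARD('r) * max_tail t (nonvanishing t F) \<alpha>
    - 2 * (\<Sum>k=1..t. \<alpha> k * of_nat (rk X (F k)))"
proof -
  interpret upset_pattern t "nonvanishing t F" by (rule upset_pattern_nonvanishing[OF assms])
  let ?c = "\<Sum>k=1..t. \<alpha> k * of_nat (rk X (F k))" and ?r = "of_nat CARD('r) :: rat"
  let ?T = "{gamma X t F \<alpha> i + gamma X t F \<alpha> j | i j. i \<in> {1..t+1} \<and> j \<in> {1..t+1} \<and> nonvanishing t F i j}"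
  have gg: "gamma X t F \<alpha> i + gamma X t F \<alpha> j = 2 * ?c - ?r * (tail t \<alpha> i + tail t \<alpha> j)"
    if "i \<in> {1..t+1}" "j \<in> {1..t+1}" for i j
    using gamma_eq[OF assms that(1), of \<alpha>] gamma_eq[OF assms that(2), of \<alpha>] by (simp add: algebra_simps)
  have "Min ?T = 2 * ?c - ?r * max_tail t (nonvanishing t F) \<alpha>"
  proof (rule Min_eqI)
    show "finite ?T"
      by (rule finite_subset[of _ "(\<lambda>(i, j). gamma X t F \<alpha> i + gamma X t F \<alpha> j) ` ({1..t+1} \<times> {1..t+1})"]) auto
    show "2 * ?c - ?r * max_tail t (nonvanishing t F) \<alpha> \<le> y" if y: "y \<in> ?T" for y
    proof -
      obtain i j where ij: "y = gamma X t F \<alpha> i + gamma X t F \<alpha> j" "i \<in> {1..t+1}" "j \<in> {1..t+1}" "nonvanishing t F i j"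
        using y by blast
      then have "tail t \<alpha> i + tail t \<alpha> j \<le> max_tail t (nonvanishing t F) \<alpha>" by (intro max_tail_ge)
      then have "?r * (tail t \<alpha> i + tail t \<alpha> j) \<le> ?r * max_tail t (nonvanishing t F) \<alpha>"
        by (rule mult_left_mono) simp
      then show ?thesis unfolding ij(1) gg[OF ij(2,3)] by simp
    qed
    obtain a b where "nonvanishing t F a b" "1 \<le> a" "a \<le> b" "b \<le> Suc t"
        "max_tail t (nonvanishing t F) \<alpha> = tail t \<alpha> a + tail t \<alpha> b"
      by (rule max_tail_attained)
    then show "2 * ?c - ?r * max_tail t (nonvanishing t F) \<alpha> \<in> ?T"
      using gg[of a b] by (intro CollectI exI[of _ a] exI[of _ b]) auto
  qed
  then show ?thesis unfolding mu_def by simp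
qed

lemma mu_1:
  assumes "filtration X E 1 (\<lambda>_. F)"
  shows "mu X Q 1 (\<lambda>_. F) (\<lambda>_. 1) = of_nat CARD('r) * of_nat (k_inv X Q F) - 2 * of_nat (rk X F)"
  unfolding mu_eq[OF assms]
  using max_tail_1[OF upset_pattern_nonvanishing[OF assms], of "\<lambda>_. 1"] kappa_nonvanishing[of 1 1 "\<lambda>_. F"]
  by simp

text \<open>The rank terms of \<open>mu\<close> are additive and cancel in
  \<open>noncritical\<close>, and the common factor \<open>CARD('r)\<close> is nonzero; what remains
  is whether \<open>max_tail\<close> is additive.\<close>

lemma critical_2_iff:
  assumes "filtration X E 2 F"
  shows "critical X Q 2 F (\<lambda>_. 1) \<longleftrightarrow>
    nonzero_on X Q (sub_prod (F 1) whole) \<and> nonzero_on X Q (sub_prod (F 2) (F 2))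
    \<and> \<not> nonzero_on X Q (sub_prod (F 1) (F 2))" (is "_ = ?crit")
    and "critical X Q 2 F (\<lambda>_. 1) \<Longrightarrow>
      mu X Q 2 F (\<lambda>_. 1) = 2 * of_nat CARD('r) - 2 * (of_nat (rk X (F 1)) + of_nat (rk X (F 2)))"
proof -
  interpret upset_pattern 2 "nonvanishing 2 F" by (rule upset_pattern_nonvanishing[OF assms])
  have two: "{1..2::nat} = {1, 2}" by auto
  have R: "nonvanishing 2 F 1 3 \<longleftrightarrow> nonzero_on X Q (sub_prod (F 1) whole)"
      "nonvanishing 2 F 2 2 \<longleftrightarrow> nonzero_on X Q (sub_prod (F 2) (F 2))"
      "nonvanishing 2 F 1 2 \<longleftrightarrow> nonzero_on X Q (sub_prod (F 1) (F 2))"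
    by (auto simp: step_def)
  have mt: "max_tail 2 (nonvanishing 2 F) (\<lambda>_. 1)
      = (if ?crit then 2 else of_nat (k_inv X Q (F 1)) + of_nat (k_inv X Q (F 2)))"
    using max_tail_2_cases[OF upset_pattern_axioms] R kappa_nonvanishing[of _ 2 F] by simp
  \<comment> \<open>The pattern forces the invariants 1 and 2, whose sum 3 differs from the value 2
    of the maximum.\<close>
  have k3: "k_inv X Q (F 1) + k_inv X Q (F 2) \<noteq> 2" if "?crit"
    using that by (auto simp: k_inv_def)
  have single: "mu X Q 1 (\<lambda>_. F i) (\<lambda>_. 1)
      = of_nat CARD('r) * of_nat (k_inv X Q (F i)) - 2 * of_nat (rk X (F i))" if "i \<in> {1..2}" for i
    using filtration_member[OF assms that] by (intro mu_1 filtration_1)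
  have mu2: "mu X Q 2 F (\<lambda>_. 1) = of_nat CARD('r) * max_tail 2 (nonvanishing 2 F) (\<lambda>_. 1)
      - 2 * (of_nat (rk X (F 1)) + of_nat (rk X (F 2)))"
    unfolding mu_eq[OF assms] by (simp add: two del: One_nat_def)
  have "noncritical X Q 2 F (\<lambda>_. 1) \<longleftrightarrow>
    of_nat CARD('r) * max_tail 2 (nonvanishing 2 F) (\<lambda>_. 1)
      = (of_nat CARD('r) * (of_nat (k_inv X Q (F 1)) + of_nat (k_inv X Q (F 2))) :: rat)"
    unfolding noncritical_def mu2 using single[of 1] single[of 2] by (auto simp: two algebra_simps simp del: One_nat_def)
  also have "\<dots> \<longleftrightarrow> max_tail 2 (nonvanishing 2 F) (\<lambda>_. 1) = of_nat (k_inv X Q (F 1) + k_inv X Q (F 2))"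
    by simp
  also have "\<dots> \<longleftrightarrow> \<not> ?crit"
    unfolding mt using k3 by (metis of_nat_add of_nat_eq_iff of_nat_numeral)
  finally show *: "critical X Q 2 F (\<lambda>_. 1) \<longleftrightarrow> ?crit" by blast
  show "mu X Q 2 F (\<lambda>_. 1) = 2 * of_nat CARD('r) - 2 * (of_nat (rk X (F 1)) + of_nat (rk X (F 2)))"
    if "critical X Q 2 F (\<lambda>_. 1)"
    using that unfolding * mu2 mt by simp
qed

section \<open>Stability as a family of numerical inequalities\<close>

definition slope_defect :: "rat \<Rightarrow> ('n, 'r) fibre_family \<Rightarrow> rat" where
  "slope_defect \<delta> F = of_int (bundle_degree X E whole) * of_nat (rk X F)
     - of_nat CARD('r) * of_int (bundle_degree X E F) - 2 * \<delta> * of_nat (rk X F)"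

text \<open>\<open>slope_defect\<close> absorbs the degree terms and the rank term of
  \<open>mu\<close>, all of them linear in the weights; only \<open>max_tail\<close> couples
  different members.\<close>

lemma stability_value:
  assumes "filtration X E t F"
  shows "P_wt X E t F \<alpha> + \<delta> * mu X Q t F \<alpha>
    = (\<Sum>i=1..t. \<alpha> i * slope_defect \<delta> (F i)) + \<delta> * of_nat CARD('r) * max_tail t (nonvanishing t F) \<alpha>"
  unfolding P_wt_def mu_eq[OF assms] slope_defect_def
  by (simp add: algebra_simps sum_subtractf sum.distrib sum_distrib_left)

lemma stability_value_1:
  assumes "filtration X E 1 (\<lambda>_. F)"
  shows "P_wt X E 1 (\<lambda>_. F) (\<lambda>_. 1) + \<delta> * mu X Q 1 (\<lambda>_. F) (\<lambda>_. 1)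
    = slope_defect \<delta> F + \<delta> * of_nat CARD('r) * of_nat (k_inv X Q F)"
  unfolding mu_1[OF assms] P_wt_def slope_defect_def by (simp add: algebra_simps)

lemma stability_value_critical:
  assumes "filtration X E 2 F" and "critical X Q 2 F (\<lambda>_. 1)"
  shows "P_wt X E 2 F (\<lambda>_. 1) + \<delta> * mu X Q 2 F (\<lambda>_. 1)
    = slope_defect \<delta> (F 1) + slope_defect \<delta> (F 2) + 2 * (\<delta> * of_nat CARD('r))"
proof -
  have "{1..2::nat} = {1, 2}" by auto
  then show ?thesis
    unfolding critical_2_iff(2)[OF assms] P_wt_def slope_defect_def by (simp add: algebra_simps)
qed

text \<open>Clears the denominators \<open>rk X F\<close> and \<open>CARD('r)\<close>, both
  positive.\<close>

lemma slope_conditions: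
  assumes "rk X F > 0"
  shows "(of_int (bundle_degree X E F) - \<delta> * of_nat k) / of_nat (rk X F)
        \<le> (of_int (bundle_degree X E whole) - 2 * \<delta>) / of_nat CARD('r)
      \<longleftrightarrow> slope_defect \<delta> F + \<delta> * of_nat CARD('r) * of_nat k \<ge> 0"
    and "(of_int (bundle_degree X E F) - \<delta> * of_nat k) / of_nat (rk X F)
        < (of_int (bundle_degree X E whole) - 2 * \<delta>) / of_nat CARD('r)
      \<longleftrightarrow> slope_defect \<delta> F + \<delta> * of_nat CARD('r) * of_nat k > 0"
  unfolding slope_defect_def using assms by (simp_all add: divide_simps, simp_all add: algebra_simps)

lemma pair_condition:
  "of_int (int (rk X F + rk X G) * bundle_degree X E whole
      - int CARD('r) * (bundle_degree X E F + bundle_degree X E G))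
    - 2 * \<delta> * of_int (int (rk X F) + int (rk X G) - int CARD('r))
   = slope_defect \<delta> F + slope_defect \<delta> G + 2 * (\<delta> * of_nat CARD('r))"
  unfolding slope_defect_def by (simp add: algebra_simps)

lemma critical_pair:
  assumes "filtration X E t F" and "i \<in> {1..t}" and "j \<in> {1..t}" and "i < j"
    and "nonvanishing t F i (Suc t)" and "nonvanishing t F j j" and "\<not> nonvanishing t F i j"
  shows "critical X Q 2 (\<lambda>k. if k = 1 then F i else F j) (\<lambda>_. 1)"
  using assms by (subst critical_2_iff(1)[OF filtration_pair[OF assms(1-4)]]) (auto simp: step_def)

text \<open>One direction evaluates the inequality at filtrations of length one and at critical
  ones, with unit weights. The other is \<open>weighted_sum_nonneg\<close> with
  \<open>w i = slope_defect \<delta> (F i)\<close> and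
  \<open>D = \<delta> * of_nat CARD('r)\<close>.\<close>

lemma delta_semistable_iff:
  assumes "\<delta> > 0"
  shows "delta_semistable X E Q \<delta> \<longleftrightarrow>
    (\<forall>F. subbundle X E F \<and> strict_sub X zero_sub F \<and> strict_sub X F whole \<longrightarrow>
       slope_defect \<delta> F + \<delta> * of_nat CARD('r) * of_nat (k_inv X Q F) \<ge> 0) \<and>
    (\<forall>F. filtration X E 2 F \<and> critical X Q 2 F (\<lambda>_. 1) \<longrightarrow>
       slope_defect \<delta> (F 1) + slope_defect \<delta> (F 2) + 2 * (\<delta> * of_nat CARD('r)) \<ge> 0)"
    (is "_ \<longleftrightarrow> ?single \<and> ?pair")
proof (intro iffI conjI allI impI)
  fix F assume "delta_semistable X E Q \<delta>"
    and F: "subbundle X E F \<and> strict_sub X zero_sub F \<and> strict_sub X F whole"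
  then have "P_wt X E 1 (\<lambda>_. F) (\<lambda>_. 1) + \<delta> * mu X Q 1 (\<lambda>_. F) (\<lambda>_. 1) \<ge> 0"
    unfolding delta_semistable_def weighted_filtration_def using filtration_1 by simp
  then show "slope_defect \<delta> F + \<delta> * of_nat CARD('r) * of_nat (k_inv X Q F) \<ge> 0"
    using stability_value_1 filtration_1 F by simp
next
  fix F assume "delta_semistable X E Q \<delta>" and F: "filtration X E 2 F \<and> critical X Q 2 F (\<lambda>_. 1)"
  then have "P_wt X E 2 F (\<lambda>_. 1) + \<delta> * mu X Q 2 F (\<lambda>_. 1) \<ge> 0"
    unfolding delta_semistable_def weighted_filtration_def by simp
  then show "slope_defect \<delta> (F 1) + slope_defect \<delta> (F 2) + 2 * (\<delta> * of_nat CARD('r)) \<ge> 0"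
    using stability_value_critical F by simp
next
  assume B: "?single \<and> ?pair"
  show "delta_semistable X E Q \<delta>"
    unfolding delta_semistable_def weighted_filtration_def
  proof (intro allI impI, elim conjE)
    fix t F \<alpha> assume F: "filtration X E t F" and \<alpha>: "\<forall>i\<in>{1..t}. \<alpha> i > (0::rat)"
    interpret upset_pattern t "nonvanishing t F" by (rule upset_pattern_nonvanishing[OF F])
    show "P_wt X E t F \<alpha> + \<delta> * mu X Q t F \<alpha> \<ge> 0"
      unfolding stability_value[OF F]
    proof (rule weighted_sum_nonneg)
      show "slope_defect \<delta> (F i) + \<delta> * of_nat CARD('r) * of_nat (kappa t (nonvanishing t F) i) \<ge> 0"
        if "i \<in> {1..t}" for i
        using B filtration_member[OF F that] kappa_nonvanishing[OF that] by simp
      show "slope_defect \<delta> (F i) + slope_defect \<delta> (F j) + 2 * (\<delta> * of_nat CARD('r)) \<ge> 0"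
        if ij: "i \<in> {1..t}" "j \<in> {1..t}" "i < j" "nonvanishing t F i (Suc t)" "nonvanishing t F j j"
          "\<not> nonvanishing t F i j" for i j
        \<comment> \<open>The members \<open>F i\<close> and \<open>F j\<close> form a critical
          filtration of their own, so condition (2) applies to them.\<close>
        using conjunct2[OF B, rule_format, OF conjI, OF filtration_pair[OF F ij(1-3)] critical_pair[OF F ij]]
        by simp
    qed (use assms \<alpha> in \<open>auto intro: less_imp_le\<close>)
  qed
qed

text \<open>Same argument with \<open>weighted_sum_pos\<close>, whose premises on length and weights
  hold since a weighted filtration has at least one step and strictly positive weights.\<close>

lemma delta_stable_iff:
  assumes "\<delta> > 0"
  shows "delta_stable X E Q \<delta> \<longleftrightarrow>
    (\<forall>F. subbundle X E F \<and> strict_sub X zero_sub F \<and> strict_sub X F whole \<longrightarrow>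
       slope_defect \<delta> F + \<delta> * of_nat CARD('r) * of_nat (k_inv X Q F) > 0) \<and>
    (\<forall>F. filtration X E 2 F \<and> critical X Q 2 F (\<lambda>_. 1) \<longrightarrow>
       slope_defect \<delta> (F 1) + slope_defect \<delta> (F 2) + 2 * (\<delta> * of_nat CARD('r)) > 0)"
    (is "_ \<longleftrightarrow> ?single \<and> ?pair")
proof (intro iffI conjI allI impI)
  fix F assume "delta_stable X E Q \<delta>"
    and F: "subbundle X E F \<and> strict_sub X zero_sub F \<and> strict_sub X F whole"
  then have "P_wt X E 1 (\<lambda>_. F) (\<lambda>_. 1) + \<delta> * mu X Q 1 (\<lambda>_. F) (\<lambda>_. 1) > 0"
    unfolding delta_stable_def weighted_filtration_def using filtration_1 by simp
  then show "slope_defect \<delta> F + \<delta> * of_nat CARD('r) * of_nat (k_inv X Q F) > 0"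
    using stability_value_1 filtration_1 F by simp
next
  fix F assume "delta_stable X E Q \<delta>" and F: "filtration X E 2 F \<and> critical X Q 2 F (\<lambda>_. 1)"
  then have "P_wt X E 2 F (\<lambda>_. 1) + \<delta> * mu X Q 2 F (\<lambda>_. 1) > 0"
    unfolding delta_stable_def weighted_filtration_def by simp
  then show "slope_defect \<delta> (F 1) + slope_defect \<delta> (F 2) + 2 * (\<delta> * of_nat CARD('r)) > 0"
    using stability_value_critical F by simp
next
  assume B: "?single \<and> ?pair"
  show "delta_stable X E Q \<delta>"
    unfolding delta_stable_def weighted_filtration_def
  proof (intro allI impI, elim conjE)
    fix t F \<alpha> assume F: "filtration X E t F" and \<alpha>: "\<forall>i\<in>{1..t}. \<alpha> i > (0::rat)"
    interpret upset_pattern t "nonvanishing t F" by (rule upset_pattern_nonvanishing[OF F])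
    show "P_wt X E t F \<alpha> + \<delta> * mu X Q t F \<alpha> > 0"
      unfolding stability_value[OF F]
    proof (rule weighted_sum_pos)
      show "slope_defect \<delta> (F i) + \<delta> * of_nat CARD('r) * of_nat (kappa t (nonvanishing t F) i) > 0"
        if "i \<in> {1..t}" for i
        using B filtration_member[OF F that] kappa_nonvanishing[OF that] by simp
      show "slope_defect \<delta> (F i) + slope_defect \<delta> (F j) + 2 * (\<delta> * of_nat CARD('r)) > 0"
        if ij: "i \<in> {1..t}" "j \<in> {1..t}" "i < j" "nonvanishing t F i (Suc t)" "nonvanishing t F j j"
          "\<not> nonvanishing t F i j" for i j
        using conjunct2[OF B, rule_format, OF conjI, OF filtration_pair[OF F ij(1-3)] critical_pair[OF F ij]]
        by simp
      show "t \<ge> 1" using F by (simp add: filtration_def)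
    qed (use assms \<alpha> in auto)
  qed
qed

end

theorem corollary17:
  fixes X :: "('n::finite) point set"
    and N :: "('n, 1) atlas"
    and E :: "('n, 'r::finite) atlas"
    and Q :: "('n, 'r) quadratic_map"
    and \<delta> :: rat and r :: nat and d :: int
  assumes "smooth_projective_curve X" and "genus X \<ge> 1"
    and "line_bundle X N"
    and "\<delta> > 0"
    and "quadric_bundle X N E Q"
    and "r = CARD('r)" and "d = bundle_degree X E whole"
  shows "(delta_semistable X E Q \<delta> \<longleftrightarrow>
      (\<forall>F. subbundle X E F \<and> strict_sub X zero_sub F \<and> strict_sub X F whole \<longrightarrow>
         (of_int (bundle_degree X E F) - \<delta> * of_nat (k_inv X Q F)) / of_nat (rk X F)
           \<le> (of_int d - 2 * \<delta>) / of_nat r) \<and>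
      (\<forall>F. filtration X E 2 F \<and> critical X Q 2 F (\<lambda>_. 1) \<longrightarrow>
         of_int (int (rk X (F 1) + rk X (F 2)) * d
                 - int r * (bundle_degree X E (F 1) + bundle_degree X E (F 2)))
           - 2 * \<delta> * of_int (int (rk X (F 1)) + int (rk X (F 2)) - int r) \<ge> 0))
    \<and> (delta_stable X E Q \<delta> \<longleftrightarrow>
      (\<forall>F. subbundle X E F \<and> strict_sub X zero_sub F \<and> strict_sub X F whole \<longrightarrow>
         (of_int (bundle_degree X E F) - \<delta> * of_nat (k_inv X Q F)) / of_nat (rk X F)
           < (of_int d - 2 * \<delta>) / of_nat r) \<and>
      (\<forall>F. filtration X E 2 F \<and> critical X Q 2 F (\<lambda>_. 1) \<longrightarrow>
         of_int (int (rk X (F 1) + rk X (F 2)) * d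
                 - int r * (bundle_degree X E (F 1) + bundle_degree X E (F 2)))
           - 2 * \<delta> * of_int (int (rk X (F 1)) + int (rk X (F 2)) - int r) > 0))"
proof -
  have "X \<noteq> {}"
    using assms(1) by (simp add: smooth_projective_curve_def irreducible_closed_def)
  then interpret nonzero_quadric X E Q
    using assms(5) by unfold_locales (auto simp: quadric_bundle_def)
  \<comment> \<open>Positive rank lets \<open>slope_conditions\<close> rewrite condition (1);
    condition (2) is rewritten by the identity \<open>pair_condition\<close>.\<close>
  have slope: "subbundle X E F \<and> strict_sub X zero_sub F \<and> strict_sub X F whole \<Longrightarrow> rk X F > 0" for F
    using rk_pos by blast
  show ?thesis
    unfolding delta_semistable_iff[OF assms(4)] delta_stable_iff[OF assms(4)] assms(6,7) pair_condition
    using slope_conditions[OF slope] by (simp cong: imp_cong)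
qed

end
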